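(* Let $\alpha>0$, $s\in\mathbb{N}$, and let $w_\alpha(x)=x^\alpha e^{-x}$, $x\in(0,\infty)$, be the Laguerre weight. Then $\operatorname{ind}w_\alpha\ge s$ if and only if $\alpha>s-1$.
   Context: Let $\{p_n\}_{n\in\mathbb{Z}_+}$, $\mathbb{Z}_+=\{0,1,2,\dots\}$, be the orthonormal polynomials with respect to $w_\alpha$ on $(0,\infty)$, i.e. $p_n(x)=\sqrt{n!/\Gamma(n+1+\alpha)}\,L_n^{(\alpha)}(x)$ with $L_n^{(\alpha)}$ the Laguerre polynomials, and let $\varphi_n=\sqrt{w_\alpha}\,p_n$. The differentiation matrix $\mathcal{D}$ is the infinite matrix with entries $\mathcal{D}_{m,n}=\int_0^\infty\varphi_m'(x)\varphi_n(x)\,dx$, $m,n\in\mathbb{Z}_+$. The weight $w_\alpha$ has index $s\in\mathbb{N}\cup\{\infty\}$, written $\operatorname{ind}w_\alpha=s$, if the powers $\mathcal{D}^k$ are bounded for $k=1,\dots,s$ while $\mathcal{D}^{s+1}$ is unbounded ($\operatorname{ind}w_\alpha=\infty$ if all powers are bounded); thus $\operatorname{ind}w_\alpha\ge s$ means that $\mathcal{D}^k$ is bounded for $k=1,\dots,s$. Here "$\mathcal{D}^k$ is bounded" is meant entrywise: every entry $(\mathcal{D}^k)_{m,n}$, $m,n\in\mathbb{Z}_+$, of the $k$-th power of the infinite matrix is finite. Absolute convergence of the sums defining these entries is not required: it is a separate condition ("absolute boundedness") that implies boundedness. *)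

theory Defs
  imports "HOL-Analysis.Analysis" "HOL-Library.Extended_Nat"
begin

definition laguerre_weight :: "real \<Rightarrow> real \<Rightarrow> real" where
  "laguerre_weight \<alpha> x = x powr \<alpha> * exp (- x)"

definition laguerre_poly :: "real \<Rightarrow> nat \<Rightarrow> real \<Rightarrow> real" where
  "laguerre_poly \<alpha> n x =
     (\<Sum>i\<le>n. (- 1) ^ i * ((real n + \<alpha>) gchoose (n - i)) * x ^ i / fact i)"

definition orthonormal_laguerre :: "real \<Rightarrow> nat \<Rightarrow> real \<Rightarrow> real" where
  "orthonormal_laguerre \<alpha> n x =
     sqrt (fact n / Gamma (real n + 1 + \<alpha>)) * laguerre_poly \<alpha> n x"

definition W_function :: "real \<Rightarrow> nat \<Rightarrow> real \<Rightarrow> real" where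
  "W_function \<alpha> n x = sqrt (laguerre_weight \<alpha> x) * orthonormal_laguerre \<alpha> n x"

definition diff_matrix :: "real \<Rightarrow> nat \<Rightarrow> nat \<Rightarrow> real" where
  "diff_matrix \<alpha> m n = (LBINT x:{0<..}. deriv (W_function \<alpha> m) x * W_function \<alpha> n x)"

text \<open>The integral above is 0 by convention when it does not exist, so finiteness of the entries
  of the matrix itself is a separate condition.\<close>

definition diff_matrix_exists :: "real \<Rightarrow> bool" where
  "diff_matrix_exists \<alpha> \<longleftrightarrow>
     (\<forall>m n. set_integrable lborel {0<..} (\<lambda>x. deriv (W_function \<alpha> m) x * W_function \<alpha> n x))"

text \<open>The \<open>(m, n)\<close> entry of the \<open>k\<close>-th power of an infinite matrix \<open>M\<close> is the multiple series
  of \<open>M m l\<^sub>1 * M l\<^sub>1 l\<^sub>2 * \<dots> * M l\<^sub>j n\<close> over all \<open>l\<^sub>1, \<dots>, l\<^sub>j\<close>, where \<open>j = k - 1\<close>.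
  The list holds the intermediate indices.\<close>

fun path_product :: "(nat \<Rightarrow> nat \<Rightarrow> real) \<Rightarrow> nat \<Rightarrow> nat list \<Rightarrow> nat \<Rightarrow> real" where
  "path_product M m [] n = M m n"
| "path_product M m (l # ls) n = M m l * path_product M l ls n"

definition power_partial_sum :: "(nat \<Rightarrow> nat \<Rightarrow> real) \<Rightarrow> nat list \<Rightarrow> nat \<Rightarrow> nat \<Rightarrow> real" where
  "power_partial_sum M Ns m n = (\<Sum>ls\<in>{ls. list_all2 (<) ls Ns}. path_product M m ls n)"

text \<open>Convergence of the multiple series is understood in Pringsheim's sense: the rectangular
  partial sums converge as all bounds tend to infinity independently of each other. This allows
  conditional convergence (unlike \<open>has_sum\<close>, which on the reals is absolute), and for \<open>k = 2\<close>
  it is convergence of an ordinary series. For \<open>k \<ge> 3\<close> it differs from forming the matrix products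
  one after the other: there, cancellation in the inner sums makes the outer sums converge in some
  cases where the multiple series does not, e.g. for \<open>\<alpha> = 2\<close> and \<open>k = 3\<close>.\<close>

definition has_power_entry ::
  "(nat \<Rightarrow> nat \<Rightarrow> real) \<Rightarrow> nat \<Rightarrow> nat \<Rightarrow> nat \<Rightarrow> real \<Rightarrow> bool" where
  "has_power_entry M k m n S \<longleftrightarrow>
     (\<forall>\<epsilon>>0. \<exists>K. \<forall>Ns. length Ns = k - 1 \<longrightarrow> (\<forall>N\<in>set Ns. K \<le> N) \<longrightarrow>
        \<bar>power_partial_sum M Ns m n - S\<bar> < \<epsilon>)"

definition power_bounded :: "real \<Rightarrow> nat \<Rightarrow> bool" where
  "power_bounded \<alpha> k \<longleftrightarrow>
     diff_matrix_exists \<alpha> \<and> (\<forall>m n. \<exists>S. has_power_entry (diff_matrix \<alpha>) k m n S)"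

text \<open>\<open>LEAST\<close> picks the \<open>s\<close> for which the powers \<open>1, \<dots>, s\<close> are bounded and the power \<open>s + 1\<close>
  is not. The value is 0 when already the first power is unbounded.\<close>

definition laguerre_ind :: "real \<Rightarrow> enat" where
  "laguerre_ind \<alpha> =
     (if \<forall>k\<ge>1. power_bounded \<alpha> k then \<infinity>
      else enat (LEAST s. \<not> power_bounded \<alpha> (Suc s)))"

end

theory Submission
  imports Defs
begin

text \<open>The differentiation matrix is explicit. With \<open>c n = norm_factor \<alpha> n\<close>, the normalising
  factor of the \<open>n\<close>-th orthonormal Laguerre polynomial, its entries are \<open>c n / (2 * c m)\<close> for \<open>m < n\<close>,
  and it is skew-symmetric (\<open>diff_matrix_less\<close>, \<open>diff_matrix_skew\<close>). The reason is that
  for \<open>m < n\<close> orthogonality removes everything from the integrand except the value at 0 that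
  the singular term \<open>\<alpha> / (2 * x)\<close> of the logarithmic derivative picks out. Moreover
  \<open>(c n)\<^sup>2\<close> is of exact order \<open>(1 + n) powr - \<alpha>\<close> (\<open>norm_factor_two_sided\<close>).

  An entry of the \<open>k\<close>-th power is a sum over paths with \<open>k - 1\<close> intermediate indices, and for
  \<open>k \<ge> 1\<close> it converges for all positions exactly if \<open>\<alpha> > k - 1\<close> (\<open>power_bounded_iff\<close>), from
  which the value of the index follows.

  If \<open>\<alpha> > k - 1\<close>, telescoping shows that a path product is at most a constant times
  \<open>(1 + L) powr - \<alpha>\<close>, with \<open>L\<close> the largest intermediate index
  (\<open>path_product_abs_le_visited\<close>). For \<open>k \<ge> 2\<close> the number of paths with a given \<open>L\<close> is of
  order \<open>L\<close> to the power \<open>k - 2\<close>, so the series converges absolutely (\<open>path_product_summable\<close>).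

  If \<open>\<alpha> \<le> k - 1\<close>, cancellation does not help: rectangular convergence forces the sums over
  boxes of lists far away from the origin to tend to 0 (\<open>rectangular_limit_imp_box_sum_bound\<close>),
  and a box in which all paths increase until their last step has terms of one sign, whose sum is
  bounded away from 0 (\<open>power_not_bounded\<close>).\<close>

section \<open>Moments of the Gamma density\<close>

definition gamma_moment :: "real \<Rightarrow> real poly \<Rightarrow> real" where
  "gamma_moment a p = (LBINT x:{0<..}. x powr (a - 1) * exp (- x) * poly p x)"

lemma has_bochner_integral_Gamma:
  assumes "a > (0::real)"
  shows "has_bochner_integral lborel (\<lambda>x. indicator {0<..} x * (x powr (a - 1) * exp (- x))) (Gamma a)"
proof (rule has_bochner_integral_nn_integral)
  have "(\<integral>\<^sup>+ x. ennreal (indicator {0<..} x * (x powr (a - 1) * exp (- x))) \<partial>lborel)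
      = (\<integral>\<^sup>+ x. ennreal (indicator {0..} x * x powr (a - 1) / exp x) \<partial>lborel)"
    by (intro nn_integral_cong arg_cong[where f = ennreal])
      (auto simp: indicator_def exp_minus field_simps)
  then show "(\<integral>\<^sup>+ x. ennreal (indicator {0<..} x * (x powr (a - 1) * exp (- x))) \<partial>lborel)
      = ennreal (Gamma a)"
    using Gamma_conv_nn_integral_real[OF assms] by simp
qed (use assms in \<open>auto simp: Gamma_real_pos less_imp_le\<close>)

text \<open>By induction on the polynomial: splitting off the constant coefficient leaves
  \<open>x\<close> times a polynomial, and the factor \<open>x\<close> raises the parameter \<open>a\<close> by one.\<close>

lemma gamma_weight_poly_integrable:
  fixes a :: real
  assumes "a > 0"
  shows "set_integrable lborel {0<..} (\<lambda>x. x powr (a - 1) * exp (- x) * poly p x)"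
  using assms
proof (induction p arbitrary: a)
  case 0
  then show ?case by (simp add: set_integrable_def)
next
  case (pCons c p)
  have "set_integrable lborel {0<..} (\<lambda>x. x powr (a - 1) * exp (- x))"
    using has_bochner_integral_Gamma[OF pCons.prems]
    by (simp add: set_integrable_def has_bochner_integral_iff)
  then have "set_integrable lborel {0<..} (\<lambda>x. c * (x powr (a - 1) * exp (- x)) +
      x powr (a + 1 - 1) * exp (- x) * poly p x)"
    using pCons.IH[of "a + 1"] pCons.prems by (intro set_integral_add set_integrable_mult_right) auto
  also have "?this \<longleftrightarrow> ?case"
    by (intro set_integrable_cong) (auto simp: powr_diff field_simps)
  finally show ?case .
qed

lemma gamma_moment_add:
  "a > 0 \<Longrightarrow> gamma_moment a (p + q) = gamma_moment a p + gamma_moment a q"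
  unfolding gamma_moment_def
  by (subst set_integral_add(2)[symmetric])
    (auto simp: gamma_weight_poly_integrable distrib_left)

lemma gamma_moment_smult: "gamma_moment a (smult c p) = c * gamma_moment a p"
  unfolding gamma_moment_def
  by (subst set_integral_mult_right[symmetric]) (simp add: mult_ac)

lemma gamma_moment_0 [simp]: "gamma_moment a 0 = 0"
  by (simp add: gamma_moment_def set_lebesgue_integral_def)

text \<open>Multiplication by \<open>x\<close> shifts the parameter, so moments can be computed by recursion on the
  coefficient list. All later facts about these integrals use this recursion instead of
  integration.\<close>

lemma gamma_moment_pCons:
  assumes "a > 0"
  shows "gamma_moment a (pCons c p) = c * Gamma a + gamma_moment (a + 1) p"
proof -
  have G: "set_integrable lborel {0<..} (\<lambda>x. x powr (a - 1) * exp (- x))"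
    "(LBINT x:{0<..}. x powr (a - 1) * exp (- x)) = Gamma a"
    using has_bochner_integral_Gamma[OF assms]
    by (simp_all add: set_integrable_def set_lebesgue_integral_def has_bochner_integral_iff)
  have "gamma_moment a (pCons c p) = (LBINT x:{0<..}. c * (x powr (a - 1) * exp (- x)) +
      x powr (a + 1 - 1) * exp (- x) * poly p x)"
    unfolding gamma_moment_def
    by (intro set_lebesgue_integral_cong) (auto simp: powr_diff field_simps)
  also have "\<dots> = c * Gamma a + gamma_moment (a + 1) p"
    unfolding gamma_moment_def
    using assms G gamma_weight_poly_integrable[of "a + 1" p]
    by (subst set_integral_add(2)) auto
  finally show ?thesis .
qed

lemma gamma_moment_monom:
  "a > 0 \<Longrightarrow> gamma_moment a (monom c i) = c * Gamma (a + real i)"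
  by (induction i arbitrary: a)
    (simp_all add: monom_0 monom_Suc gamma_moment_pCons add_ac)

lemma gamma_moment_sum:
  "a > 0 \<Longrightarrow> gamma_moment a (\<Sum>i\<in>A. f i) = (\<Sum>i\<in>A. gamma_moment a (f i))"
  by (induction A rule: infinite_finite_induct) (simp_all add: gamma_moment_add)

text \<open>Multiplied by \<open>x powr (a - 1) * exp (- x)\<close>, the polynomial on the left is the derivative of
  \<open>x powr a * exp (- x) * poly q x\<close>, which vanishes at both ends of \<open>(0, \<infinity>)\<close>. The proof is
  algebraic: on the constant term the claim is the functional equation of \<open>Gamma\<close>, and the shift
  of \<open>a\<close> takes care of the rest.\<close>

lemma gamma_moment_total_derivative:
  assumes "a > 0"
  shows "gamma_moment a (pCons 0 (pderiv q) + [:a, - 1:] * q) = 0"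
  using assms
proof (induction q arbitrary: a)
  case 0
  then show ?case by simp
next
  case (pCons c q)
  define R where "R = pCons 0 (pderiv q) + [:a + 1, - 1:] * q"
  have "pCons 0 (pderiv (pCons c q)) + [:a, - 1:] * pCons c q = pCons (a * c) ([:- c:] + R)"
    by (rule poly_ext) (simp add: R_def pderiv_pCons algebra_simps)
  moreover have "gamma_moment (a + 1) R = 0"
    unfolding R_def using pCons.prems by (intro pCons.IH) simp
  moreover have "gamma_moment (a + 1) [:- c:] = - c * Gamma (a + 1)"
    using pCons.prems by (subst gamma_moment_pCons) auto
  moreover have "Gamma (a + 1) = a * Gamma a"
    using pCons.prems by (intro Gamma_plus1) (auto elim: nonpos_Ints_cases)
  ultimately show ?case
    using pCons.prems by (simp only: gamma_moment_pCons gamma_moment_add) simp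
qed

section \<open>Laguerre polynomials\<close>

definition laguerre_polynomial :: "real \<Rightarrow> nat \<Rightarrow> real poly" where
  "laguerre_polynomial \<alpha> n =
     (\<Sum>i\<le>n. monom ((- 1) ^ i * ((real n + \<alpha>) gchoose (n - i)) / fact i) i)"

lemma poly_laguerre_polynomial: "poly (laguerre_polynomial \<alpha> n) x = laguerre_poly \<alpha> n x"
  by (simp add: laguerre_polynomial_def laguerre_poly_def poly_sum poly_monom field_simps)

lemma degree_laguerre_polynomial: "degree (laguerre_polynomial \<alpha> n) \<le> n"
  unfolding laguerre_polynomial_def
  by (intro degree_sum_le) (auto intro: order.trans[OF degree_monom_le])

lemma coeff_0_laguerre_polynomial:
  "coeff (laguerre_polynomial \<alpha> n) 0 = (real n + \<alpha>) gchoose n"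
proof -
  have "coeff (laguerre_polynomial \<alpha> n) 0
      = (\<Sum>i\<le>n. if i = 0 then (real n + \<alpha>) gchoose n else 0)"
    unfolding laguerre_polynomial_def coeff_sum by (intro sum.cong) auto
  then show ?thesis by simp
qed

text \<open>The moments \<open>Gamma (\<alpha> + j + i)\<close> turn the explicit sum for the Laguerre polynomial into
  a Chu-Vandermonde convolution with upper index \<open>-(\<alpha> + j) + (n + \<alpha>) = n - j\<close>. The value is
  \<open>Gamma \<alpha>\<close> for \<open>j = 0\<close> and 0 for \<open>1 \<le> j \<le> n\<close>.\<close>

lemma gamma_moment_shifted_laguerre:
  assumes "\<alpha> > 0"
  shows "gamma_moment (\<alpha> + real j) (laguerre_polynomial \<alpha> n)
    = Gamma (\<alpha> + real j) * ((real n - real j) gchoose n)"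
proof -
  let ?b = "\<alpha> + real j"
  have b: "?b > 0" using assms by simp
  have "gamma_moment ?b (laguerre_polynomial \<alpha> n)
      = (\<Sum>i\<le>n. (- 1) ^ i * ((real n + \<alpha>) gchoose (n - i)) / fact i * Gamma (?b + real i))"
    unfolding laguerre_polynomial_def using b by (simp add: gamma_moment_sum gamma_moment_monom)
  also have "\<dots> = (\<Sum>i\<le>n. Gamma ?b * ((- ?b gchoose i) * ((real n + \<alpha>) gchoose (n - i))))"
  proof (intro sum.cong refl)
    fix i
    have "?b \<notin> \<int>\<^sub>\<le>\<^sub>0" using b by (auto elim: nonpos_Ints_cases)
    then have "Gamma (?b + real i) = Gamma ?b * pochhammer ?b i"
      using pochhammer_Gamma[of ?b i] Gamma_real_pos[OF b] by simp
    then show "(- 1) ^ i * ((real n + \<alpha>) gchoose (n - i)) / fact i * Gamma (?b + real i)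
        = Gamma ?b * ((- ?b gchoose i) * ((real n + \<alpha>) gchoose (n - i)))"
      unfolding gbinomial_pochhammer[of "- ?b"] minus_minus by simp
  qed
  also have "\<dots> = Gamma ?b * ((- ?b + (real n + \<alpha>)) gchoose n)"
    using gbinomial_Vandermonde[of "- ?b" "real n + \<alpha>" n]
    by (simp add: atLeast0AtMost flip: sum_distrib_left)
  finally show ?thesis by (simp add: algebra_simps)
qed

text \<open>Since \<open>x\<close> to the power \<open>j\<close> is absorbed in the shifted parameter, this is the orthogonality of
  the \<open>n\<close>-th Laguerre polynomial, with respect to the weight with exponent \<open>\<alpha>\<close>, to all
  polynomials of degree below \<open>n\<close>.\<close>

lemma laguerre_orthogonal:
  assumes "\<alpha> > 0" "j \<ge> 1" "degree q + j \<le> n"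
  shows "gamma_moment (\<alpha> + real j) (laguerre_polynomial \<alpha> n * q) = 0"
  using assms(2,3)
proof (induction q arbitrary: j)
  case 0
  then show ?case by simp
next
  case (pCons c q)
  have "(real n - real j) gchoose n = 0"
    using pCons.prems by (simp flip: of_nat_diff binomial_gbinomial)
  then have L: "gamma_moment (\<alpha> + real j) (laguerre_polynomial \<alpha> n) = 0"
    using gamma_moment_shifted_laguerre[OF assms(1)] by simp
  have "gamma_moment (\<alpha> + real (Suc j)) (laguerre_polynomial \<alpha> n * q) = 0"
    using pCons.IH[of "Suc j"] pCons.prems by (cases "q = 0") auto
  then show ?case
    using L assms(1) by (simp add: gamma_moment_add gamma_moment_smult gamma_moment_pCons add_ac)
qed

text \<open>The weight here has exponent \<open>\<alpha> - 1\<close>. All of \<open>q\<close> but its constant term is divisible by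
  \<open>x\<close>, and this factor restores the exponent \<open>\<alpha>\<close>, so orthogonality removes it.\<close>

lemma gamma_moment_laguerre_mult:
  assumes "\<alpha> > 0" "degree q \<le> n"
  shows "gamma_moment \<alpha> (laguerre_polynomial \<alpha> n * q) = coeff q 0 * Gamma \<alpha>"
proof (cases q)
  case (pCons c q')
  have "gamma_moment (\<alpha> + 1) (laguerre_polynomial \<alpha> n * q') = 0"
    using laguerre_orthogonal[of \<alpha> 1 q' n] assms pCons by (cases "q' = 0") auto
  moreover have "(real n gchoose n) = 1"
    by (simp flip: binomial_gbinomial)
  ultimately show ?thesis
    using assms pCons gamma_moment_shifted_laguerre[of \<alpha> 0 n]
    by (simp add: gamma_moment_add gamma_moment_smult gamma_moment_pCons)
qed

section \<open>The entries of the differentiation matrix\<close>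

definition norm_factor :: "real \<Rightarrow> nat \<Rightarrow> real" where
  "norm_factor \<alpha> n = sqrt (fact n / Gamma (real n + 1 + \<alpha>))"

lemma norm_factor_pos: "\<alpha> > 0 \<Longrightarrow> norm_factor \<alpha> n > 0"
  by (simp add: norm_factor_def Gamma_real_pos)

lemma norm_factor_square:
  "\<alpha> > 0 \<Longrightarrow> (norm_factor \<alpha> n)\<^sup>2 = fact n / Gamma (real n + 1 + \<alpha>)"
  by (simp add: norm_factor_def Gamma_real_pos less_imp_le)

text \<open>For \<open>x > 0\<close> the derivative of \<open>x powr (\<alpha> / 2) * exp (- x / 2) * L x\<close>, where \<open>L\<close> is the
  \<open>m\<close>-th Laguerre polynomial, is \<open>x powr (\<alpha> / 2 - 1) * exp (- x / 2)\<close> times this polynomial.\<close>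

definition derivative_factor :: "real \<Rightarrow> nat \<Rightarrow> real poly" where
  "derivative_factor \<alpha> m =
     pCons 0 (pderiv (laguerre_polynomial \<alpha> m)) + [:\<alpha> / 2, - 1 / 2:] * laguerre_polynomial \<alpha> m"

lemma W_function_eq:
  assumes "x > 0"
  shows "W_function \<alpha> n x
    = x powr (\<alpha> / 2) * exp (- x / 2) * (norm_factor \<alpha> n * poly (laguerre_polynomial \<alpha> n) x)"
proof -
  have "x powr \<alpha> = (x powr (\<alpha> / 2))\<^sup>2" "exp (- x) = (exp (- x / 2))\<^sup>2"
    by (simp_all add: power2_eq_square flip: powr_add exp_add)
  then have "sqrt (x powr \<alpha> * exp (- x)) = x powr (\<alpha> / 2) * exp (- x / 2)"
    by (simp add: real_sqrt_mult)
  then show ?thesis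
    by (simp add: W_function_def laguerre_weight_def orthonormal_laguerre_def norm_factor_def
        poly_laguerre_polynomial)
qed

lemma deriv_W_function:
  assumes "x > 0"
  shows "deriv (W_function \<alpha> m) x
    = x powr (\<alpha> / 2 - 1) * exp (- x / 2) * (norm_factor \<alpha> m * poly (derivative_factor \<alpha> m) x)"
proof -
  let ?L = "laguerre_polynomial \<alpha> m"
  have p: "x powr (\<alpha> / 2) = x * x powr (\<alpha> / 2 - 1)"
    using assms by (simp add: powr_diff)
  have "((\<lambda>x. x powr (\<alpha> / 2) * exp (- x / 2) * (norm_factor \<alpha> m * poly ?L x)) has_real_derivative
      x powr (\<alpha> / 2 - 1) * exp (- x / 2) * (norm_factor \<alpha> m * poly (derivative_factor \<alpha> m) x)) (at x)"
    using assms
    by (auto intro!: derivative_eq_intros simp: derivative_factor_def p algebra_simps)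
  then have "(W_function \<alpha> m has_real_derivative
      x powr (\<alpha> / 2 - 1) * exp (- x / 2) * (norm_factor \<alpha> m * poly (derivative_factor \<alpha> m) x)) (at x)"
    by (rule has_field_derivative_transform_within_open[where S = "{0<..}"])
      (use assms in \<open>auto simp: W_function_eq\<close>)
  then show ?thesis by (rule DERIV_imp_deriv)
qed

lemma diff_matrix_integrand:
  assumes "x > 0"
  shows "deriv (W_function \<alpha> m) x * W_function \<alpha> n x
    = x powr (\<alpha> - 1) * exp (- x) * poly (smult (norm_factor \<alpha> m * norm_factor \<alpha> n)
        (laguerre_polynomial \<alpha> n * derivative_factor \<alpha> m)) x"
proof -
  have "x powr (\<alpha> - 1) = x powr (\<alpha> / 2 - 1) * x powr (\<alpha> / 2)"
    by (simp flip: powr_add)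
  moreover have "exp (- x) = exp (- x / 2) * exp (- x / 2)"
    by (simp add: mult_exp_exp)
  ultimately show ?thesis
    using assms by (simp add: W_function_eq deriv_W_function mult_ac)
qed

lemma diff_matrix_exists_of_pos:
  assumes "\<alpha> > 0"
  shows "diff_matrix_exists \<alpha>"
  unfolding diff_matrix_exists_def
proof (intro allI)
  fix m n
  show "set_integrable lborel {0<..} (\<lambda>x. deriv (W_function \<alpha> m) x * W_function \<alpha> n x)"
    using gamma_weight_poly_integrable[OF assms, of "smult (norm_factor \<alpha> m * norm_factor \<alpha> n)
        (laguerre_polynomial \<alpha> n * derivative_factor \<alpha> m)"]
    by (rule set_integrable_cong[THEN iffD2, rotated 3]) (auto simp: diff_matrix_integrand)
qed

lemma diff_matrix_eq_moment:
  "diff_matrix \<alpha> m n = norm_factor \<alpha> m * norm_factor \<alpha> n *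
     gamma_moment \<alpha> (laguerre_polynomial \<alpha> n * derivative_factor \<alpha> m)"
  unfolding diff_matrix_def gamma_moment_smult[symmetric] unfolding gamma_moment_def
  by (intro set_lebesgue_integral_cong) (auto simp: diff_matrix_integrand)

text \<open>The two integrands add up to the derivative of a product that vanishes at 0, because
  \<open>\<alpha> > 0\<close>, and at infinity.\<close>

lemma diff_matrix_skew:
  assumes "\<alpha> > 0"
  shows "diff_matrix \<alpha> n m = - diff_matrix \<alpha> m n"
proof -
  let ?L = "laguerre_polynomial \<alpha>"
  have "?L n * derivative_factor \<alpha> m + ?L m * derivative_factor \<alpha> n
      = pCons 0 (pderiv (?L m * ?L n)) + [:\<alpha>, - 1:] * (?L m * ?L n)"
  proof (rule poly_ext)
    fix x
    show "poly (?L n * derivative_factor \<alpha> m + ?L m * derivative_factor \<alpha> n) x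
      = poly (pCons 0 (pderiv (?L m * ?L n)) + [:\<alpha>, - 1:] * (?L m * ?L n)) x"
      by (simp add: derivative_factor_def pderiv_mult field_simps)
  qed
  then have "gamma_moment \<alpha> (?L n * derivative_factor \<alpha> m)
      + gamma_moment \<alpha> (?L m * derivative_factor \<alpha> n) = 0"
    using gamma_moment_total_derivative[OF assms, of "?L m * ?L n"] assms
    by (simp flip: gamma_moment_add)
  then have "gamma_moment \<alpha> (?L m * derivative_factor \<alpha> n)
      = - gamma_moment \<alpha> (?L n * derivative_factor \<alpha> m)" by linarith
  then show ?thesis
    by (simp add: diff_matrix_eq_moment)
qed

text \<open>As \<open>m < n\<close>, the polynomial factor of the derivative has degree at most \<open>n\<close>, so only its
  value at 0 contributes to the integral. That value comes from the term
  \<open>\<alpha> / (2 * x)\<close> in the logarithmic derivative of the square root of the weight.\<close>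

lemma diff_matrix_less:
  assumes "\<alpha> > 0" "m < n"
  shows "diff_matrix \<alpha> m n = norm_factor \<alpha> n / (2 * norm_factor \<alpha> m)"
proof -
  let ?L = "laguerre_polynomial \<alpha> m" and ?G = "Gamma (real m + 1 + \<alpha>)"
  have "degree (pCons 0 (pderiv ?L)) \<le> n" "degree ([:\<alpha> / 2, - 1 / 2:] * ?L) \<le> n"
    using degree_laguerre_polynomial[of \<alpha> m] degree_pCons_le[of 0 "pderiv ?L"]
      degree_mult_le[of "[:\<alpha> / 2, - 1 / 2:]" ?L] assms
    by (auto simp: degree_pderiv split: if_splits)
  then have "degree (derivative_factor \<alpha> m) \<le> n"
    unfolding derivative_factor_def by (rule degree_add_le)
  moreover have "coeff (derivative_factor \<alpha> m) 0 = \<alpha> / 2 * ((real m + \<alpha>) gchoose m)"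
    by (simp add: derivative_factor_def coeff_0_laguerre_polynomial)
  moreover have "((real m + \<alpha>) gchoose m) = ?G / (fact m * Gamma (\<alpha> + 1))"
  proof -
    have "\<alpha> + 1 \<notin> \<int>\<^sub>\<le>\<^sub>0" using assms by (auto elim: nonpos_Ints_cases)
    then show ?thesis
      using pochhammer_Gamma[of "\<alpha> + 1" m] by (simp add: gbinomial_pochhammer' add_ac)
  qed
  moreover have "Gamma (\<alpha> + 1) = \<alpha> * Gamma \<alpha>"
    using assms by (intro Gamma_plus1) (auto elim: nonpos_Ints_cases)
  moreover have "Gamma \<alpha> \<noteq> 0" using Gamma_real_pos[OF assms(1)] by (metis less_irrefl)
  ultimately have "diff_matrix \<alpha> m n
      = norm_factor \<alpha> m * norm_factor \<alpha> n * (?G / (2 * fact m))"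
    using assms by (simp add: diff_matrix_eq_moment gamma_moment_laguerre_mult)
  also have "\<dots> = norm_factor \<alpha> m * norm_factor \<alpha> n / (2 * (norm_factor \<alpha> m)\<^sup>2)"
    using assms by (simp add: norm_factor_square)
  also have "\<dots> = norm_factor \<alpha> n / (2 * norm_factor \<alpha> m)"
    using norm_factor_pos[OF assms(1), of m] by (simp add: power2_eq_square)
  finally show ?thesis .
qed

section \<open>Size of the entries and of path products\<close>

text \<open>Both bounds express that \<open>fact n / Gamma (n + 1 + \<alpha>)\<close> times
  \<open>(1 + n) powr \<alpha>\<close> has a positive limit, which is Euler's limit formula for \<open>Gamma \<alpha>\<close>.
  A positive sequence with a positive limit is bounded, and so are its reciprocals.\<close>

lemma norm_factor_two_sided:
  assumes "\<alpha> > 0"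
  obtains c C where "c > 0" "C > 0"
    "\<And>n. c * (1 + real n) powr - \<alpha> \<le> (norm_factor \<alpha> n)\<^sup>2"
    "\<And>n. (norm_factor \<alpha> n)\<^sup>2 \<le> C * (1 + real n) powr - \<alpha>"
proof -
  define b where "b n = (norm_factor \<alpha> n)\<^sup>2 * (1 + real n) powr \<alpha>" for n
  have b_pos: "b n > 0" for n
    using norm_factor_pos[OF assms, of n] by (simp add: b_def)
  have G0: "Gamma \<alpha> \<noteq> 0" using Gamma_real_pos[OF assms] by (metis less_irrefl)
  have "(\<lambda>n. Gamma_series \<alpha> n / Gamma \<alpha> * (real (Suc n) / real n) powr \<alpha>) \<longlonglongrightarrow> Gamma \<alpha> / Gamma \<alpha> * 1 powr \<alpha>"
    using G0 by (intro tendsto_intros LIMSEQ_Suc_n_over_n) auto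
  moreover have "\<forall>\<^sub>F n in sequentially.
      Gamma_series \<alpha> n / Gamma \<alpha> * (real (Suc n) / real n) powr \<alpha> = b n"
    using eventually_gt_at_top[of 0]
  proof eventually_elim
    case (elim n)
    have "\<alpha> \<notin> \<int>\<^sub>\<le>\<^sub>0" using assms by (auto elim: nonpos_Ints_cases)
    then have "pochhammer \<alpha> (n + 1) = Gamma (real n + 1 + \<alpha>) / Gamma \<alpha>"
      by (simp add: pochhammer_Gamma add_ac)
    moreover have "exp (\<alpha> * ln (real n)) = real n powr \<alpha>"
      using elim by (simp add: powr_def)
    ultimately show ?case
      using elim G0 assms
      by (simp add: Gamma_series_def b_def norm_factor_square powr_divide add_ac)
  qed
  ultimately have lim: "b \<longlonglongrightarrow> 1"
    using G0 by (auto elim: Lim_transform_eventually)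
  then have "(\<lambda>n. inverse (b n)) \<longlonglongrightarrow> inverse 1"
    by (intro tendsto_inverse) auto
  with lim have "Bseq b" "Bseq (\<lambda>n. inverse (b n))"
    by (auto intro!: convergent_imp_Bseq convergentI)
  then obtain C D where CD: "C > 0" "\<And>n. norm (b n) \<le> C" "D > 0" "\<And>n. norm (inverse (b n)) \<le> D"
    by (auto simp: Bseq_def)
  have sq: "(norm_factor \<alpha> n)\<^sup>2 = b n * (1 + real n) powr - \<alpha>" for n
    by (simp add: b_def powr_minus)
  show ?thesis
  proof (rule that[of "inverse D" C])
    fix n
    have "inverse D \<le> b n"
      using CD(4)[of n] b_pos[of n] CD(3)
      by (metis abs_of_pos inverse_inverse_eq inverse_positive_iff_positive le_imp_inverse_le real_norm_def)
    then show "inverse D * (1 + real n) powr - \<alpha> \<le> (norm_factor \<alpha> n)\<^sup>2"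
      unfolding sq by (intro mult_right_mono) auto
    show "(norm_factor \<alpha> n)\<^sup>2 \<le> C * (1 + real n) powr - \<alpha>"
      unfolding sq using CD(2)[of n] by (intro mult_right_mono) auto
  qed (use CD in auto)
qed

lemma norm_factor_antimono:
  assumes "\<alpha> > 0" "m \<le> n"
  shows "norm_factor \<alpha> n \<le> norm_factor \<alpha> m"
  using assms(2)
proof (induction n rule: dec_induct)
  case base
  then show ?case by simp
next
  case (step n)
  have np: "real n + 1 + \<alpha> \<notin> \<int>\<^sub>\<le>\<^sub>0" using assms(1) by (auto elim: nonpos_Ints_cases)
  have "Gamma (real (Suc n) + 1 + \<alpha>) = (real n + 1 + \<alpha>) * Gamma (real n + 1 + \<alpha>)"
    using Gamma_plus1[of "real n + 1 + \<alpha>", OF np] assms(1)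
    by (simp add: add_ac)
  then have "fact (Suc n) / Gamma (real (Suc n) + 1 + \<alpha>)
      = (real n + 1) / (real n + 1 + \<alpha>) * (fact n / Gamma (real n + 1 + \<alpha>))"
    by (simp add: add_ac)
  also have "\<dots> \<le> 1 * (fact n / Gamma (real n + 1 + \<alpha>))"
    using assms(1) by (intro mult_right_mono) (auto simp: Gamma_real_pos less_imp_le)
  finally have "norm_factor \<alpha> (Suc n) \<le> norm_factor \<alpha> n"
    by (simp add: norm_factor_def del: fact_Suc of_nat_Suc)
  then show ?case using step.IH by linarith
qed

text \<open>An off-diagonal entry has absolute value half the ratio of the smaller to the larger of the two
  norm factors, which is at most either of their two quotients. This form telescopes along a path, and
  so does its mirror image, by skew-symmetry.\<close>

lemma diff_matrix_abs_le:
  assumes "\<alpha> > 0"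
  shows "\<bar>diff_matrix \<alpha> m n\<bar> \<le> norm_factor \<alpha> n / norm_factor \<alpha> m"
proof (cases m n rule: linorder_cases)
  case less
  then show ?thesis
    using diff_matrix_less[OF assms less] norm_factor_pos[OF assms, of m] norm_factor_pos[OF assms, of n]
    by (simp add: field_simps)
next
  case equal
  then show ?thesis
    using diff_matrix_skew[OF assms, of m m] norm_factor_pos[OF assms] by (simp add: less_imp_le)
next
  case greater
  note pos = norm_factor_pos[OF assms]
  have le: "norm_factor \<alpha> m \<le> norm_factor \<alpha> n"
    using norm_factor_antimono[OF assms, of n m] greater by simp
  have "\<bar>diff_matrix \<alpha> m n\<bar> = norm_factor \<alpha> m / (2 * norm_factor \<alpha> n)"
    using diff_matrix_less[OF assms greater] diff_matrix_skew[OF assms, of m n] pos[of m] pos[of n]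
    by simp
  also have "\<dots> \<le> 1"
    using le pos[of m] pos[of n] by (simp add: divide_le_eq)
  also have "1 \<le> norm_factor \<alpha> n / norm_factor \<alpha> m"
    using le pos[of m] by simp
  finally show ?thesis .
qed

lemma path_product_abs_le:
  assumes "\<alpha> > 0"
  shows "\<bar>path_product (diff_matrix \<alpha>) m ls n\<bar> \<le> norm_factor \<alpha> m / norm_factor \<alpha> n"
proof (induction ls arbitrary: m)
  case Nil
  then show ?case
    using diff_matrix_abs_le[OF assms, of n m] diff_matrix_skew[OF assms, of n m] by simp
next
  case (Cons l ls)
  have "\<bar>diff_matrix \<alpha> m l\<bar> \<le> norm_factor \<alpha> m / norm_factor \<alpha> l"
    using diff_matrix_abs_le[OF assms, of l m] diff_matrix_skew[OF assms, of l m] by simp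
  then have "\<bar>path_product (diff_matrix \<alpha>) m (l # ls) n\<bar>
      \<le> norm_factor \<alpha> m / norm_factor \<alpha> l * (norm_factor \<alpha> l / norm_factor \<alpha> n)"
    unfolding path_product.simps abs_mult
    using Cons norm_factor_pos[OF assms]
    by (intro mult_mono) (auto simp: less_imp_le)
  then show ?case using norm_factor_pos[OF assms, of l] by simp
qed

text \<open>Up to the visit of \<open>L\<close>, bound a step from \<open>l\<close> to \<open>l'\<close> by
  \<open>norm_factor \<alpha> l' / norm_factor \<alpha> l\<close>, and after it by the reciprocal quotient. The two
  telescoping products meet at \<open>L\<close>. The bound holds for every visited index, in particular for the largest one.\<close>

lemma path_product_abs_le_visited:
  assumes "\<alpha> > 0" "L \<in> set ls"
  shows "\<bar>path_product (diff_matrix \<alpha>) m ls n\<bar>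
    \<le> (norm_factor \<alpha> L)\<^sup>2 / (norm_factor \<alpha> m * norm_factor \<alpha> n)"
  using assms(2)
proof (induction ls arbitrary: m)
  case Nil
  then show ?case by simp
next
  case (Cons l ls)
  note pos = norm_factor_pos[OF assms(1)]
  have "\<bar>path_product (diff_matrix \<alpha>) l ls n\<bar>
      \<le> (norm_factor \<alpha> L)\<^sup>2 / (norm_factor \<alpha> l * norm_factor \<alpha> n)"
  proof (cases "L = l")
    case True
    then show ?thesis
      using path_product_abs_le[OF assms(1), of l ls n] pos[of l] by (simp add: power2_eq_square)
  next
    case False
    then show ?thesis using Cons by simp
  qed
  then have "\<bar>path_product (diff_matrix \<alpha>) m (l # ls) n\<bar>
      \<le> norm_factor \<alpha> l / norm_factor \<alpha> m *
        ((norm_factor \<alpha> L)\<^sup>2 / (norm_factor \<alpha> l * norm_factor \<alpha> n))"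
    unfolding path_product.simps abs_mult
    using diff_matrix_abs_le[OF assms(1)] pos by (intro mult_mono) (auto simp: less_imp_le)
  then show ?case using pos[of l] by simp
qed

section \<open>Sums over boxes of lists\<close>

lemma finite_listset: "\<forall>A\<in>set As. finite A \<Longrightarrow> finite (listset As)"
proof (induction As)
  case (Cons A As)
  have "listset (A # As) = (\<lambda>(x, xs). x # xs) ` (A \<times> listset As)"
    by (auto simp: set_Cons_def)
  with Cons show ?case by simp
qed simp

lemma sum_listset_Cons:
  assumes "finite A"
  shows "(\<Sum>ls\<in>listset (A # As). g ls) = (\<Sum>x\<in>A. \<Sum>ls\<in>listset As. g (x # ls))"
proof -
  have "(\<Sum>ls\<in>listset (A # As). g ls) = (\<Sum>(x, ls)\<in>A \<times> listset As. g (x # ls))"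
    by (rule sum.reindex_bij_witness[where j = "\<lambda>ls. (hd ls, tl ls)" and i = "\<lambda>(x, ls). x # ls"])
      (auto simp: set_Cons_def)
  then show ?thesis by (simp add: sum.cartesian_product)
qed

lemma card_listset:
  "\<forall>A\<in>set As. finite A \<Longrightarrow> card (listset As) = prod_list (map card As)"
proof (induction As)
  case Nil
  then show ?case by simp
next
  case (Cons A As)
  then show ?case
    unfolding card_eq_sum[of "listset (A # As)"] by (subst sum_listset_Cons) auto
qed

lemma listset_lessThan: "listset (map lessThan Ns) = {ls. list_all2 (<) ls Ns}"
  by (induction Ns) (auto simp: set_Cons_def list_all2_Cons2)

section \<open>Convergence for large exponents\<close>

text \<open>The lists bounded by \<open>Ns\<close> contain any given finite set of lists as soon as all bounds exceed
  every entry that occurs in that set. Hence the rectangular partial sums form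
  part of the net of all finite partial sums.\<close>

lemma power_entry_exists_if_abs_summable:
  assumes "(\<lambda>ls. path_product M m ls n) summable_on {ls. length ls = k - 1}"
  shows "\<exists>S. has_power_entry M k m n S"
proof -
  let ?X = "{ls :: nat list. length ls = k - 1}"
  obtain S where S: "((\<lambda>ls. path_product M m ls n) has_sum S) ?X"
    using assms by (auto simp: summable_on_def)
  have "has_power_entry M k m n S"
    unfolding has_power_entry_def
  proof (intro allI impI)
    fix \<epsilon> :: real assume "\<epsilon> > 0"
    with S have "\<forall>\<^sub>F Y in finite_subsets_at_top ?X. dist (\<Sum>ls\<in>Y. path_product M m ls n) S < \<epsilon>"
      unfolding has_sum_def by (rule tendstoD)
    then obtain F where F: "finite F" "F \<subseteq> ?X" and close:
      "\<And>Y. finite Y \<Longrightarrow> F \<subseteq> Y \<Longrightarrow> Y \<subseteq> ?X \<Longrightarrow> dist (\<Sum>ls\<in>Y. path_product M m ls n) S < \<epsilon>"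
      unfolding eventually_finite_subsets_at_top by auto
    define K where "K = Suc (Max (insert 0 (\<Union>ls\<in>F. set ls)))"
    have K: "l < K" if "ls \<in> F" "l \<in> set ls" for ls l
      unfolding K_def using that F(1) by (auto simp: less_Suc_eq_le intro!: Max_ge)
    show "\<exists>K. \<forall>Ns. length Ns = k - 1 \<longrightarrow> (\<forall>N\<in>set Ns. K \<le> N) \<longrightarrow>
        \<bar>power_partial_sum M Ns m n - S\<bar> < \<epsilon>"
    proof (intro exI[of _ K] allI impI)
      fix Ns assume Ns: "length Ns = k - 1" "\<forall>N\<in>set Ns. K \<le> N"
      let ?Y = "{ls. list_all2 (<) ls Ns}"
      have "finite ?Y"
        unfolding listset_lessThan[symmetric] by (rule finite_listset) auto
      moreover have "F \<subseteq> ?Y"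
      proof
        fix ls assume ls: "ls \<in> F"
        then have len: "length ls = length Ns" using F(2) Ns by auto
        moreover have "ls ! i < Ns ! i" if "i < length ls" for i
        proof -
          have "ls ! i < K" using K[OF ls] that by simp
          also have "K \<le> Ns ! i" using Ns(2) that len by simp
          finally show ?thesis .
        qed
        ultimately show "ls \<in> ?Y" by (simp add: list_all2_conv_all_nth)
      qed
      moreover have "?Y \<subseteq> ?X"
        using Ns by (auto dest: list_all2_lengthD)
      ultimately show "\<bar>power_partial_sum M Ns m n - S\<bar> < \<epsilon>"
        using close[of ?Y] by (simp add: power_partial_sum_def dist_real_def)
    qed
  qed
  then show ?thesis ..
qed

lemma summable_on_prod_list:
  fixes f :: "'a \<Rightarrow> real"
  assumes "f summable_on UNIV" "\<And>x. f x \<ge> 0"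
  shows "(\<lambda>ls. prod_list (map f ls)) summable_on {ls. length ls = j}"
proof (induction j)
  case 0
  then show ?case by simp
next
  case (Suc j)
  let ?X = "{ls :: 'a list. length ls = j}"
  let ?I = "infsum (\<lambda>ls. prod_list (map f ls)) ?X"
  have nonneg: "prod_list (map f ls) \<ge> 0" for ls
    using assms(2) by (induction ls) auto
  have inj: "inj_on (\<lambda>(x, ls). x # ls) (UNIV \<times> ?X)"
    by (auto intro!: inj_onI)
  have "(\<lambda>(x, ls). f x * prod_list (map f ls)) summable_on UNIV \<times> ?X"
  proof (rule summable_on_SigmaI)
    show "((\<lambda>ls. case (x, ls) of (x, ls) \<Rightarrow> f x * prod_list (map f ls)) has_sum (f x * ?I)) ?X" for x
      using Suc by (auto intro!: has_sum_cmult_right has_sum_infsum)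
    show "(\<lambda>x. f x * ?I) summable_on UNIV"
      using assms(1) by (rule summable_on_cmult_left)
  qed (use assms(2) nonneg in auto)
  also have "(\<lambda>(x, ls). f x * prod_list (map f ls))
      = (\<lambda>ls. prod_list (map f ls)) \<circ> (\<lambda>(x, ls). x # ls)"
    by (auto simp: fun_eq_iff)
  finally have "(\<lambda>ls. prod_list (map f ls)) summable_on (\<lambda>(x, ls). x # ls) ` (UNIV \<times> ?X)"
    by (simp only: summable_on_reindex[OF inj])
  also have "(\<lambda>(x, ls). x # ls) ` (UNIV \<times> ?X) = {ls. length ls = Suc j}"
    by (auto simp: length_Suc_conv image_iff)
  finally show ?case .
qed

text \<open>For \<open>k \<ge> 2\<close> a path product is dominated by \<open>(1 + L) powr - \<alpha>\<close> with \<open>L\<close> the largest of the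
  \<open>k - 1\<close> intermediate indices. Splitting the exponent evenly among all of them bounds it by
  the product of the \<open>(1 + l) powr - \<beta>\<close> with \<open>\<beta> = \<alpha> / (k - 1)\<close>, and \<open>\<beta> > 1\<close>
  makes each factor summable.\<close>

lemma path_product_summable:
  assumes "\<alpha> > 0" "k \<ge> 1" "\<alpha> > real k - 1"
  shows "(\<lambda>ls. path_product (diff_matrix \<alpha>) m ls n) summable_on {ls. length ls = k - 1}"
proof (cases "k = 1")
  case True
  then show ?thesis by simp
next
  case False
  define \<beta> where "\<beta> = \<alpha> / real (k - 1)"
  have k: "real (k - 1) > 0" "real (k - 1) = real k - 1" using assms False by auto
  have \<beta>: "\<beta> > 1" unfolding \<beta>_def using k assms by (simp add: field_simps)
  obtain C where C: "C > 0" "\<And>n. (norm_factor \<alpha> n)\<^sup>2 \<le> C * (1 + real n) powr - \<alpha>"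
    using norm_factor_two_sided[OF assms(1)] by metis
  define f where "f l = (1 + real l) powr - \<beta>" for l :: nat
  have "summable (\<lambda>l. real (Suc l) powr - \<beta>)"
    using \<beta> by (subst summable_Suc_iff) (simp add: summable_real_powr_iff)
  then have "f summable_on UNIV"
    unfolding f_def by (intro summable_nonneg_imp_summable_on) (simp_all add: add_ac)
  then have sum: "(\<lambda>ls. C / (norm_factor \<alpha> m * norm_factor \<alpha> n) * prod_list (map f ls))
      summable_on {ls. length ls = k - 1}"
    by (intro summable_on_cmult_right summable_on_prod_list) (auto simp: f_def)
  show ?thesis
  proof (rule abs_summable_summable, rule summable_on_comparison_test[OF sum])
    fix ls :: "nat list" assume "ls \<in> {ls. length ls = k - 1}"
    then have len: "length ls = k - 1" by simp
    then have ne: "ls \<noteq> []" using k by auto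
    define L where "L = Max (set ls)"
    have L: "L \<in> set ls" "\<And>l. l \<in> set ls \<Longrightarrow> l \<le> L"
      unfolding L_def using ne by auto
    have prod_ge: "f L ^ length xs \<le> prod_list (map f xs)" if "set xs \<subseteq> set ls" for xs
      using that
    proof (induction xs)
      case Nil
      then show ?case by simp
    next
      case (Cons l xs)
      have "f L \<le> f l"
        using L(2)[of l] Cons.prems \<beta> unfolding f_def by (intro powr_mono2') auto
      moreover have "f L ^ length xs \<le> prod_list (map f xs)" using Cons by simp
      moreover have "f l \<ge> 0" "f L ^ length xs \<ge> 0" by (simp_all add: f_def)
      ultimately show ?case by (simp add: mult_mono)
    qed
    have "f L ^ (k - 1) \<le> prod_list (map f ls)" using prod_ge[of ls] len by simp
    moreover have "f L ^ (k - 1) = (1 + real L) powr - \<alpha>"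
      using k by (simp add: f_def \<beta>_def powr_power)
    ultimately have "(norm_factor \<alpha> L)\<^sup>2 \<le> C * prod_list (map f ls)"
      using order.trans[OF C(2)[of L] mult_left_mono] C(1) by simp
    then have "(norm_factor \<alpha> L)\<^sup>2 / (norm_factor \<alpha> m * norm_factor \<alpha> n)
        \<le> C * prod_list (map f ls) / (norm_factor \<alpha> m * norm_factor \<alpha> n)"
      using norm_factor_pos[OF assms(1)] by (intro divide_right_mono) (auto simp: less_imp_le)
    then show "norm (path_product (diff_matrix \<alpha>) m ls n)
        \<le> C / (norm_factor \<alpha> m * norm_factor \<alpha> n) * prod_list (map f ls)"
      using path_product_abs_le_visited[OF assms(1) L(1), of m n] by simp
  qed auto
qed

section \<open>Divergence for small exponents\<close>

lemma sum_listset_Cons_swap: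
  "(\<Sum>ls\<in>listset (map (\<lambda>(A, B). {A..<B}) ((A, B) # ABs)). g ls)
    = (\<Sum>ls\<in>listset (map (\<lambda>(A, B). {A..<B}) ABs). \<Sum>x\<in>{A..<B::nat}. g (x # ls))"
  by (simp only: list.map prod.case sum_listset_Cons finite_atLeastLessThan) (rule sum.swap)

lemma slice_sum_eq_diff:
  fixes g :: "nat list \<Rightarrow> real"
  assumes "A \<le> B"
  shows "(\<Sum>ls\<in>listset (map lessThan Ns). \<Sum>x\<in>{A..<B}. g (x # ls))
    = (\<Sum>ls\<in>listset (map lessThan (B # Ns)). g ls)
    - (\<Sum>ls\<in>listset (map lessThan (A # Ns)). g ls)"
  using assms unfolding list.map sum_listset_Cons[OF finite_lessThan]
  by (subst sum.swap) (simp add: sum_diff_nat_ivl lessThan_atLeast0)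

text \<open>The sum over a box is the signed sum of the rectangular partial sums at its
  \<open>2 ^ length ABs\<close> corners.\<close>

lemma box_sum_bound:
  fixes g :: "nat list \<Rightarrow> real"
  assumes "\<And>Ns. length Ns = length ABs \<Longrightarrow> \<forall>N\<in>set Ns. K \<le> N \<Longrightarrow>
      \<bar>\<Sum>ls\<in>listset (map lessThan Ns). g ls\<bar> \<le> \<epsilon>"
    and "\<forall>(A, B)\<in>set ABs. K \<le> A \<and> A \<le> B"
  shows "\<bar>\<Sum>ls\<in>listset (map (\<lambda>(A, B). {A..<B}) ABs). g ls\<bar> \<le> 2 ^ length ABs * \<epsilon>"
  using assms
proof (induction ABs arbitrary: g \<epsilon>)
  case Nil
  then show ?case using Nil(1)[of "[]"] by simp
next
  case (Cons AB ABs)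
  obtain A B where AB: "AB = (A, B)" "K \<le> A" "A \<le> B" using Cons.prems(2) by auto
  have "\<bar>\<Sum>ls\<in>listset (map lessThan Ns). \<Sum>x\<in>{A..<B}. g (x # ls)\<bar> \<le> 2 * \<epsilon>"
    if "length Ns = length ABs" "\<forall>N\<in>set Ns. K \<le> N" for Ns
    using Cons.prems(1)[of "A # Ns"] Cons.prems(1)[of "B # Ns"] that AB
    unfolding slice_sum_eq_diff[OF AB(3)] by fastforce
  then have "\<bar>\<Sum>ls\<in>listset (map (\<lambda>(A, B). {A..<B}) ABs). \<Sum>x\<in>{A..<B}. g (x # ls)\<bar>
      \<le> 2 ^ length ABs * (2 * \<epsilon>)"
    using Cons.prems(2) by (intro Cons.IH) auto
  then show ?case by (simp only: AB(1) sum_listset_Cons_swap length_Cons power_Suc mult_ac)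
qed

text \<open>In at least one direction a difference of two partial sums is formed, which cancels the limit
  \<open>S\<close>. So Cauchy's criterion holds in the form that sums over remote boxes are small.\<close>

lemma rectangular_limit_imp_box_sum_bound:
  fixes g :: "nat list \<Rightarrow> real"
  assumes "\<And>Ns. length Ns = length ABs \<Longrightarrow> \<forall>N\<in>set Ns. K \<le> N \<Longrightarrow>
      \<bar>(\<Sum>ls\<in>listset (map lessThan Ns). g ls) - S\<bar> \<le> \<epsilon>"
    and "\<forall>(A, B)\<in>set ABs. K \<le> A \<and> A \<le> B" and "ABs \<noteq> []"
  shows "\<bar>\<Sum>ls\<in>listset (map (\<lambda>(A, B). {A..<B}) ABs). g ls\<bar> \<le> 2 ^ length ABs * \<epsilon>"
proof -
  obtain A B ABs' where AB: "ABs = (A, B) # ABs'" "K \<le> A" "A \<le> B"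
    using assms(2,3) by (cases ABs) auto
  have "\<bar>\<Sum>ls\<in>listset (map lessThan Ns). \<Sum>x\<in>{A..<B}. g (x # ls)\<bar> \<le> 2 * \<epsilon>"
    if "length Ns = length ABs'" "\<forall>N\<in>set Ns. K \<le> N" for Ns
    using assms(1)[of "A # Ns"] assms(1)[of "B # Ns"] that AB
    unfolding slice_sum_eq_diff[OF AB(3)] by fastforce
  then have "\<bar>\<Sum>ls\<in>listset (map (\<lambda>(A, B). {A..<B}) ABs'). \<Sum>x\<in>{A..<B}. g (x # ls)\<bar>
      \<le> 2 ^ length ABs' * (2 * \<epsilon>)"
    using assms(2) AB(1) by (intro box_sum_bound[where K = K]) auto
  then show ?thesis by (simp only: AB(1) sum_listset_Cons_swap length_Cons power_Suc mult_ac)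
qed

text \<open>On an increasing path every step up contributes the quotient of consecutive norm factors, and
  the product telescopes; the only descent is the final step, which gives the sign.\<close>

lemma path_product_sorted:
  assumes "\<alpha> > 0" "sorted_wrt (<) (m # ls)" "\<forall>l\<in>set ls. n < l" "ls \<noteq> []"
  shows "path_product (diff_matrix \<alpha>) m ls n
    = - ((1 / 2) ^ Suc (length ls) * (norm_factor \<alpha> (last ls))\<^sup>2 / (norm_factor \<alpha> m * norm_factor \<alpha> n))"
  using assms(2-4)
proof (induction ls arbitrary: m)
  case Nil
  then show ?case by simp
next
  case (Cons l ls)
  have D: "diff_matrix \<alpha> m l = norm_factor \<alpha> l / (2 * norm_factor \<alpha> m)"
    using Cons.prems by (intro diff_matrix_less[OF assms(1)]) auto
  show ?case
  proof (cases "ls = []")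
    case True
    have "diff_matrix \<alpha> l n = - (norm_factor \<alpha> l / (2 * norm_factor \<alpha> n))"
      using Cons.prems diff_matrix_less[OF assms(1), of n l] diff_matrix_skew[OF assms(1), of l n]
      by simp
    then show ?thesis using True D by (simp add: power2_eq_square)
  next
    case False
    have "path_product (diff_matrix \<alpha>) l ls n = - ((1 / 2) ^ Suc (length ls) *
        (norm_factor \<alpha> (last ls))\<^sup>2 / (norm_factor \<alpha> l * norm_factor \<alpha> n))"
      using Cons False by (intro Cons.IH) auto
    then show ?thesis
      using D False norm_factor_pos[OF assms(1), of l] by simp
  qed
qed

text \<open>The ranges of consecutive entries adjoin each other, so every list in the box is increasing
  and the path products from and to an index below the box all have the same sign.\<close>

lemma staircase_sorted:
  assumes "ls \<in> listset (map (\<lambda>j. {j * K..<Suc j * K}) [i..<i + r])"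
  shows "length ls = r \<and> sorted_wrt (<) ls \<and> (\<forall>l\<in>set ls. i * K \<le> l \<and> l < (i + r) * K)"
  using assms
proof (induction r arbitrary: i ls)
  case 0
  then show ?case by simp
next
  case (Suc r)
  have eq: "[i..<i + Suc r] = i # [Suc i..<Suc i + r]"
    by (subst upt_conv_Cons) auto
  have "ls \<in> set_Cons {i * K..<Suc i * K}
      (listset (map (\<lambda>j. {j * K..<Suc j * K}) [Suc i..<Suc i + r]))"
    using Suc.prems by (simp only: eq list.map listset.simps)
  then obtain x xs where ls: "ls = x # xs" "i * K \<le> x" "x < Suc i * K"
    "xs \<in> listset (map (\<lambda>j. {j * K..<Suc j * K}) [Suc i..<Suc i + r])"
    unfolding set_Cons_def mem_Collect_eq atLeastLessThan_iff by blast
  have IH: "length xs = r" "sorted_wrt (<) xs"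
    "\<And>l. l \<in> set xs \<Longrightarrow> Suc i * K \<le> l" "\<And>l. l \<in> set xs \<Longrightarrow> l < (i + Suc r) * K"
    using Suc.IH[OF ls(4)] by auto
  have mono: "i * K \<le> Suc i * K" "Suc i * K \<le> (i + Suc r) * K"
    by (intro mult_right_mono; simp)+
  have "x < l \<and> i * K \<le> l" if "l \<in> set xs" for l
    using IH(3)[OF that] ls(3) mono by linarith
  moreover have "x < (i + Suc r) * K" using ls(3) mono by linarith
  ultimately show ?case
    using ls(1,2) IH(1,2,4) by (simp del: mult_Suc mult_Suc_right add_Suc_right)
qed

text \<open>The box with ranges \<open>{j * K..<Suc j * K}\<close> for \<open>1 \<le> j < k\<close> has
  \<open>K ^ (k - 1)\<close> elements, whose path products all have the same sign and an absolute value of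
  at least a constant times \<open>K powr - \<alpha>\<close>. For \<open>\<alpha> \<le> k - 1\<close> the sum over the box therefore
  does not become small as \<open>K\<close> grows, which contradicts convergence.\<close>

lemma power_not_bounded:
  assumes "\<alpha> > 0" "k \<ge> 1" "\<alpha> \<le> real k - 1"
  shows "\<not> power_bounded \<alpha> k"
proof
  assume "power_bounded \<alpha> k"
  then obtain S where S: "has_power_entry (diff_matrix \<alpha>) k 0 0 S"
    by (auto simp: power_bounded_def)
  have k: "k \<ge> 2" using assms by (cases "k = 1") auto
  obtain c where c: "c > 0" "\<And>n. c * (1 + real n) powr - \<alpha> \<le> (norm_factor \<alpha> n)\<^sup>2"
    using norm_factor_two_sided[OF assms(1)] by metis
  \<comment> \<open>\<open>\<delta>\<close> bounds the sum over each staircase box from below; \<open>\<epsilon>\<close> is chosen so that the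
    \<open>2 ^ (k - 1)\<close> corners of the box together contribute less.\<close>
  define \<delta> where "\<delta> = (1 / 2) ^ k * c * real k powr - \<alpha> / (norm_factor \<alpha> 0)\<^sup>2"
  have \<delta>: "\<delta> > 0" using c k norm_factor_pos[OF assms(1), of 0] by (simp add: \<delta>_def)
  define \<epsilon> where "\<epsilon> = \<delta> / 2 ^ k"
  have "\<epsilon> > 0" using \<delta> by (simp add: \<epsilon>_def)
  then obtain K0 where K0: "\<And>Ns. length Ns = k - 1 \<Longrightarrow> \<forall>N\<in>set Ns. K0 \<le> N \<Longrightarrow>
      \<bar>power_partial_sum (diff_matrix \<alpha>) Ns 0 0 - S\<bar> < \<epsilon>"
    using S unfolding has_power_entry_def by blast
  define K where "K = max K0 1"
  define ABs where "ABs = map (\<lambda>j. (j * K, Suc j * K)) [1..<1 + (k - 1)]"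
  have len: "length ABs = k - 1" unfolding ABs_def length_map length_upt by simp
  let ?X = "listset (map (\<lambda>(A, B). {A..<B}) ABs)"
  have X: "?X = listset (map (\<lambda>j. {j * K..<Suc j * K}) [1..<1 + (k - 1)])"
    by (simp add: ABs_def comp_def)
  have "\<bar>\<Sum>ls\<in>?X. path_product (diff_matrix \<alpha>) 0 ls 0\<bar> \<le> 2 ^ length ABs * \<epsilon>"
  proof (rule rectangular_limit_imp_box_sum_bound)
    fix Ns :: "nat list" assume "length Ns = length ABs" "\<forall>N\<in>set Ns. K0 \<le> N"
    then show "\<bar>(\<Sum>ls\<in>listset (map lessThan Ns). path_product (diff_matrix \<alpha>) 0 ls 0) - S\<bar> \<le> \<epsilon>"
      using K0[of Ns] len by (simp add: listset_lessThan power_partial_sum_def)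
  next
    show "\<forall>(A, B)\<in>set ABs. K0 \<le> A \<and> A \<le> B"
    proof -
      have "K0 \<le> j * K" if "1 \<le> j" for j
        using mult_right_mono[OF that, of K] by (simp add: K_def)
      then show ?thesis by (auto simp: ABs_def)
    qed
    show "ABs \<noteq> []" using k len by auto
  qed
  also have "2 ^ length ABs * \<epsilon> < \<delta>"
    using k \<delta> unfolding len by (cases k) (simp_all add: \<epsilon>_def)
  finally have small: "\<bar>\<Sum>ls\<in>?X. path_product (diff_matrix \<alpha>) 0 ls 0\<bar> < \<delta>" .
  have K: "real K \<ge> 1" "K \<ge> 1" by (auto simp: K_def)
  have large: "\<delta> * real K powr - \<alpha> \<le> - path_product (diff_matrix \<alpha>) 0 ls 0" if "ls \<in> ?X" for ls
  proof -
    from that have "ls \<in> listset (map (\<lambda>j. {j * K..<Suc j * K}) [1..<1 + (k - 1)])"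
      using X by simp
    from staircase_sorted[OF this] have ls: "length ls = k - 1" "sorted_wrt (<) ls"
      "\<And>l. l \<in> set ls \<Longrightarrow> K \<le> l \<and> l < k * K" using k by auto
    have ne: "ls \<noteq> []" using ls(1) k by auto
    have "path_product (diff_matrix \<alpha>) 0 ls 0 = - ((1 / 2) ^ Suc (length ls) *
        (norm_factor \<alpha> (last ls))\<^sup>2 / (norm_factor \<alpha> 0 * norm_factor \<alpha> 0))"
      using ls ne K by (intro path_product_sorted[OF assms(1)]) (fastforce+)
    moreover have "c * (real k * real K) powr - \<alpha> \<le> (norm_factor \<alpha> (last ls))\<^sup>2"
    proof -
      have "1 + last ls \<le> k * K" using ls(3)[OF last_in_set[OF ne]] by simp
      then have "1 + real (last ls) \<le> real k * real K"
        by (metis of_nat_1 of_nat_add of_nat_le_iff of_nat_mult)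
      then have "(real k * real K) powr - \<alpha> \<le> (1 + real (last ls)) powr - \<alpha>"
        using assms(1) by (intro powr_mono2') auto
      then have "c * (real k * real K) powr - \<alpha> \<le> c * (1 + real (last ls)) powr - \<alpha>"
        using c(1) by (intro mult_left_mono) auto
      then show ?thesis using c(2)[of "last ls"] by linarith
    qed
    moreover have "Suc (length ls) = k" using ls(1) k by simp
    ultimately show ?thesis
      using norm_factor_pos[OF assms(1), of 0] k K
      by (simp add: \<delta>_def powr_mult power2_eq_square field_simps)
  qed
  have card: "card ?X = K ^ (k - 1)"
    unfolding X by (subst card_listset) (auto simp: comp_def map_replicate_const simp del: upt_Suc)
  have "\<delta> \<le> real K ^ (k - 1) * (\<delta> * real K powr - \<alpha>)"
  proof -
    have "1 \<le> real K powr (real k - 1 - \<alpha>)"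
      using K assms by (intro ge_one_powr_ge_zero) auto
    also have "\<dots> = real K ^ (k - 1) * real K powr - \<alpha>"
      using K k by (simp add: powr_diff powr_minus divide_inverse powr_realpow[symmetric] of_nat_diff)
    finally show ?thesis using \<delta> by (simp add: field_simps)
  qed
  also have "\<dots> = (\<Sum>ls\<in>?X. \<delta> * real K powr - \<alpha>)"
    using card by simp
  also have "\<dots> \<le> (\<Sum>ls\<in>?X. - path_product (diff_matrix \<alpha>) 0 ls 0)"
    by (intro sum_mono large)
  also have "\<dots> < \<delta>" using small by (simp add: sum_negf abs_less_iff)
  finally show False by simp
qed

section \<open>The index of the weight\<close>

lemma power_bounded_iff:
  assumes "\<alpha> > 0" "k \<ge> 1"
  shows "power_bounded \<alpha> k \<longleftrightarrow> \<alpha> > real k - 1"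
proof
  show "power_bounded \<alpha> k \<Longrightarrow> \<alpha> > real k - 1"
    using power_not_bounded[OF assms] by fastforce
  show "\<alpha> > real k - 1 \<Longrightarrow> power_bounded \<alpha> k"
    unfolding power_bounded_def
    using assms path_product_summable diff_matrix_exists_of_pos
    by (auto intro!: power_entry_exists_if_abs_summable)
qed

text \<open>The powers that are bounded form an initial segment, and \<open>u\<close> is its length. So
  \<open>real u\<close> is the least integer at or above \<open>\<alpha>\<close>.\<close>

theorem theorem7:
  fixes \<alpha> :: real and s :: nat
  assumes "\<alpha> > 0" and "s \<ge> 1"
  shows "laguerre_ind \<alpha> \<ge> enat s \<longleftrightarrow> \<alpha> > real s - 1"
proof -
  have iff: "power_bounded \<alpha> (Suc t) \<longleftrightarrow> real t < \<alpha>" for t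
    using power_bounded_iff[OF assms(1), of "Suc t"] by simp
  obtain t where "\<alpha> \<le> real t" using real_arch_simple by blast
  then have t: "\<not> power_bounded \<alpha> (Suc t)" using iff by simp
  define u where "u = (LEAST t. \<not> power_bounded \<alpha> (Suc t))"
  have "\<not> power_bounded \<alpha> (Suc u)"
    unfolding u_def by (rule LeastI[of "\<lambda>t. \<not> power_bounded \<alpha> (Suc t)", OF t])
  then have u: "\<alpha> \<le> real u" using iff by simp
  have below: "real j < \<alpha>" if "j < u" for j
    using not_less_Least[of j "\<lambda>t. \<not> power_bounded \<alpha> (Suc t)"] that iff by (simp add: u_def)
  have "laguerre_ind \<alpha> = enat u"
    using t unfolding laguerre_ind_def u_def by auto
  moreover have "s \<le> u \<longleftrightarrow> \<alpha> > real s - 1"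
  proof
    assume "s \<le> u"
    then show "\<alpha> > real s - 1" using below[of "s - 1"] assms(2) by (simp add: of_nat_diff)
  next
    assume "\<alpha> > real s - 1"
    then show "s \<le> u" using u by linarith
  qed
  ultimately show ?thesis by simp
qed

end
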